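(* Let $F:\Omega\subseteq\mathbb{R}^m\to\mathbb{R}^m$ with $\Omega$ non-empty, open and convex. Assume that: (C1) $x^*$ is a zero of $F$ with $\|F'(x^* )\|\le M$, and $r>0$ satisfies $B(x^*,r)\subseteq\Omega$; (C2) $B_0\in\mathcal{L}(\mathbb{R}^m,\mathbb{R}^m)$, $B_0\neq0$, $\|B_0\|=\beta$ and $\|I-B_0F'(x^* )\|=\delta<1$; (C3) $x_0\in B(x^*,r)$ and $\tilde r>0$ is such that $x_0+F(x_0)\in B(x^*,\tilde r)$ and $B(x^*,\tilde r)\subseteq\Omega$; (C4) for each pair of distinct points $x,y\in\Omega$ there exists a first order divided difference $[x,y;F]$ of $F$, and there is $k\ge0$ such that $$\|[x,y;F]-F'(x^* )\|\le k\left(\|x-x^*\|+\|y-x^*\|\right)\qquad\text{for all }x,y\in\Omega.$$ Put $\alpha_0=r$, $\beta_0=\beta$, $\delta_0=\delta$, $\alpha_1=(\delta+k\beta r)r$, $\tilde\alpha_1=(1+M+k\alpha_1)\alpha_1$, $d_0=\delta+k\beta(\alpha_1+\tilde\alpha_1)$ and $\delta_1=\delta^2+kM\beta^2(\alpha_1+\tilde\alpha_1)$, and assume that $r$ satisfies $$(1+M+kr)\,r<\tilde r,\qquad \delta_1<\delta_0,\qquad (1+d_0)^2(\delta_0+k\beta\alpha_0)<1 .$$ Then the sequence $\{x_n\}$ given, from $x_0$ and $B_0$, by $$x_{n+1}=x_n-B_nF(x_n),\qquad B_{n+1}=2B_n-B_n\,[x_{n+1},x_{n+1}+F(x_{n+1});F]\,B_n,\qquad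 n\ge0,$$ is well defined and converges to the solution $x^*$ of $F(x)=0$.
   Context: $B(x^*,\rho)=\{x\in\mathbb{R}^m:\|x-x^*\|<\rho\}$; matrix norms are the operator norms induced by the vector norm. A first order divided difference of $F$ at $u,v\in\Omega$ is a bounded linear operator $[u,v;F]$ on $\mathbb{R}^m$ with $[u,v;F](u-v)=F(u)-F(v)$. Throughout, the divided difference used is the matrix with entries $$[u,v;F]_{ij}=\frac{1}{u_j-v_j}\Big(F_i(u_1,\dots,u_j,v_{j+1},\dots,v_m)-F_i(u_1,\dots,u_{j-1},v_j,\dots,v_m)\Big),$$ where, if $u_j=v_j$, the quotient is understood as the corresponding partial derivative. The Fréchet derivative of $F$ exists in $\Omega$ and $[x,x;F]=F'(x)$. "Well defined" means that all points $x_n$ and $x_n+F(x_n)$ lie in $\Omega$, so that every step can be carried out. *)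

theory Defs
  imports "HOL-Analysis.Analysis"
begin

definition is_norm :: "(real ^ 'm \<Rightarrow> real) \<Rightarrow> bool" where
  "is_norm N \<longleftrightarrow>
     (\<forall>x. 0 \<le> N x) \<and> (\<forall>x. N x = 0 \<longleftrightarrow> x = 0) \<and>
     (\<forall>c x. N (c *\<^sub>R x) = \<bar>c\<bar> * N x) \<and>
     (\<forall>x y. N (x + y) \<le> N x + N y)"

definition nball :: "(real ^ 'm \<Rightarrow> real) \<Rightarrow> real ^ 'm \<Rightarrow> real \<Rightarrow> (real ^ 'm) set" where
  "nball N c \<rho> = {x. N (x - c) < \<rho>}"

(* The analogue of the library's onorm for an arbitrary vector norm N;
   at v = 0 the quotient is 0 / 0 = 0. *)
definition opnorm :: "(real ^ 'm \<Rightarrow> real) \<Rightarrow> real ^ 'm ^ 'm \<Rightarrow> real" where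
  "opnorm N A = (SUP v. N (A *v v) / N v)"

definition is_divided_difference ::
  "(real ^ 'm \<Rightarrow> real ^ 'm) \<Rightarrow> real ^ 'm \<Rightarrow> real ^ 'm \<Rightarrow> real ^ 'm ^ 'm \<Rightarrow> bool" where
  "is_divided_difference F u v A \<longleftrightarrow> A *v (u - v) = F u - F v"

(* (u_1, ..., u_(j-1), t, v_(j+1), ..., v_m); the linear order on the index type
   'm plays the role of the order of the coordinates 1, ..., m. *)
definition stagger ::
  "real ^ 'm::{finite,linorder} \<Rightarrow> real ^ 'm::{finite,linorder} \<Rightarrow> 'm::{finite,linorder} \<Rightarrow> real \<Rightarrow> real ^ 'm::{finite,linorder}" where
  "stagger u v j t = (\<chi> l. if l < j then u $ l else if l = j then t else v $ l)"

(* F is a total function here, so the entries are given by this formula also when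
   a staggered point lies outside the domain of interest. *)
definition divdiff ::
  "(real ^ 'm::{finite,linorder} \<Rightarrow> real ^ 'm::{finite,linorder}) \<Rightarrow> real ^ 'm::{finite,linorder} \<Rightarrow> real ^ 'm::{finite,linorder} \<Rightarrow> real ^ 'm::{finite,linorder} ^ 'm::{finite,linorder}" where
  "divdiff F u v = (\<chi> i j.
     if u $ j = v $ j then deriv (\<lambda>t. F (stagger u v j t) $ i) (u $ j)
     else (F (stagger u v j (u $ j)) $ i - F (stagger u v j (v $ j)) $ i) / (u $ j - v $ j))"

end

theory Submission
  imports Defs
begin

text \<open>
  Write \<open>A = F'(x\<^sup>*)\<close> and \<open>e\<^sub>n\<close> for the distance from \<open>x\<^sub>n\<close> to \<open>x\<^sup>*\<close>. A divided
  difference between \<open>x\<^sub>n\<close> and \<open>x\<^sup>*\<close> writes \<open>F(x\<^sub>n)\<close> as a matrix within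
  \<open>k e\<^sub>n\<close> of \<open>A\<close> applied to the error (\<open>residual_linearised\<close>), so a step multiplies the error by at
  most \<open>\<parallel>I - B\<^sub>n A\<parallel> + k \<parallel>B\<^sub>n\<parallel> e\<^sub>n\<close> (\<open>quasi_newton_error_le\<close>). The update of \<open>B\<^sub>n\<close> is one step of
  Schulz's iteration for inverting the divided difference \<open>D\<close>: it squares the residual \<open>I - B\<^sub>n A\<close>
  up to a term controlled by \<open>D - A\<close> (\<open>schulz_residual_le\<close>). The norm of \<open>B\<^sub>n\<close> may grow, but only
  by a factor \<open>1 + \<parallel>I - B\<^sub>n D\<parallel>\<close> (\<open>opnorm_schulz_le\<close>).

  The difficulty is that \<open>\<parallel>B\<^sub>n\<parallel>\<close> is not bounded beforehand. With \<open>q = \<delta> + k \<beta> r\<close> and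
  \<open>p = 1 + d0\<close>, the estimates propagate the three bounds
  \<open>e\<^sub>n \<le> q\<^sup>n e\<^sub>0\<close>, \<open>\<parallel>B\<^sub>n\<parallel> \<le> p\<^sup>n \<beta>\<close> and \<open>\<parallel>I - B\<^sub>n A\<parallel> \<le> \<delta>\<close> simultaneously. The matrix norms enter
  the perturbation terms at most quadratically, and always together with one error, so their growth
  costs at most \<open>(p\<^sup>2 q)\<^sup>n\<close>, which the hypothesis \<open>p\<^sup>2 q < 1\<close> absorbs. What remains are exactly the
  bounds that hold at the first step, namely the parameters \<open>d0\<close> and \<open>\<delta>1\<close>. Since \<open>q < 1\<close>, the
  errors tend to zero; the iterates stay in the ball of radius \<open>r\<close>, and the condition on \<open>rt\<close> keeps
  the shifted points \<open>x\<^sub>n + F(x\<^sub>n)\<close> in the domain.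
\<close>

section \<open>Arbitrary norms on a Euclidean space\<close>

context
  fixes N :: "real ^ 'm \<Rightarrow> real"
  assumes norm: "is_norm N"
begin

lemma is_norm_nonneg: "0 \<le> N v"
  using norm by (simp add: is_norm_def)

lemma is_norm_eq_0_iff: "N v = 0 \<longleftrightarrow> v = 0"
  using norm by (simp add: is_norm_def)

lemma is_norm_zero: "N 0 = 0"
  by (simp add: is_norm_eq_0_iff)

lemma is_norm_scaleR: "N (c *\<^sub>R v) = \<bar>c\<bar> * N v"
  using norm by (simp add: is_norm_def)

lemma is_norm_triangle: "N (v + w) \<le> N v + N w"
  using norm by (simp add: is_norm_def)

lemma is_norm_minus: "N (- v) = N v"
  using is_norm_scaleR[of "-1" v] by simp

lemma is_norm_diff_triangle: "N (v - w) \<le> N v + N w"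
  using is_norm_triangle[of v "- w"] by (simp add: is_norm_minus)

lemma is_norm_sum_le: "finite S \<Longrightarrow> N (\<Sum>i\<in>S. f i) \<le> (\<Sum>i\<in>S. N (f i))"
proof (induction S rule: finite_induct)
  case empty
  then show ?case by (simp add: is_norm_zero)
next
  case (insert i S)
  then show ?case using is_norm_triangle[of "f i" "sum f S"] by simp
qed

lemma is_norm_le_norm:
  obtains C where "\<And>v. N v \<le> C * norm v"
proof
  fix v :: "real ^ 'm"
  have "N v = N (\<Sum>b\<in>Basis. (v \<bullet> b) *\<^sub>R b)"
    by (simp add: euclidean_representation)
  also have "\<dots> \<le> (\<Sum>b\<in>Basis. \<bar>v \<bullet> b\<bar> * N b)"
    using is_norm_sum_le[of Basis "\<lambda>b. (v \<bullet> b) *\<^sub>R b"] by (simp add: is_norm_scaleR)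
  also have "\<dots> \<le> (\<Sum>b\<in>Basis. norm v * N b)"
    by (intro sum_mono mult_right_mono is_norm_nonneg) (rule Basis_le_norm)
  finally show "N v \<le> (\<Sum>b\<in>Basis. N b) * norm v"
    by (simp add: sum_distrib_left mult.commute)
qed

lemma is_norm_continuous: "continuous_on S N"
proof -
  obtain C where C: "\<And>v. N v \<le> C * norm v"
    using is_norm_le_norm by blast
  have "(\<bar>C\<bar>)-lipschitz_on S N"
  proof (rule lipschitz_onI)
    fix v w
    have "\<bar>N v - N w\<bar> \<le> N (v - w)"
      using is_norm_triangle[of "v - w" w] is_norm_triangle[of "w - v" v] is_norm_minus[of "v - w"]
      by simp
    also have "\<dots> \<le> \<bar>C\<bar> * norm (v - w)"
      using C[of "v - w"] by (rule order_trans) (simp add: mult_right_mono)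
    finally show "dist (N v) (N w) \<le> \<bar>C\<bar> * dist v w"
      by (simp add: dist_norm)
  qed simp
  then show ?thesis by (rule lipschitz_on_continuous_on)
qed

text \<open>A norm is continuous for the Euclidean topology and has no zero on the compact unit sphere,
  so it is bounded away from zero there.\<close>

lemma norm_le_is_norm:
  obtains c where "c > 0" "\<And>v. c * norm v \<le> N v"
proof -
  obtain u :: "real ^ 'm" where u: "u \<in> sphere 0 1" and min: "\<And>w. w \<in> sphere 0 1 \<Longrightarrow> N u \<le> N w"
    using continuous_attains_inf[OF compact_sphere _ is_norm_continuous, of 0 1] by auto
  show ?thesis
  proof
    show "N u > 0"
      using u is_norm_nonneg[of u] is_norm_eq_0_iff[of u] by (auto simp: less_le)
    fix v :: "real ^ 'm"
    show "N u * norm v \<le> N v"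
    proof (cases "v = 0")
      case True
      then show ?thesis using is_norm_nonneg by simp
    next
      case False
      then have "N u \<le> N ((1 / norm v) *\<^sub>R v)"
        by (intro min) simp
      with False show ?thesis by (simp add: is_norm_scaleR field_simps)
    qed
  qed
qed

lemma tendsto_if_is_norm_tendsto_0:
  assumes "(\<lambda>n. N (y n - a)) \<longlonglongrightarrow> 0"
  shows "y \<longlonglongrightarrow> a"
proof -
  obtain c where c: "c > 0" "\<And>v. c * norm v \<le> N v"
    using norm_le_is_norm by blast
  have "(\<lambda>n. y n - a) \<longlonglongrightarrow> 0"
  proof (rule Lim_null_comparison)
    show "\<forall>\<^sub>F n in sequentially. norm (y n - a) \<le> N (y n - a) / c"
      using c by (simp add: field_simps)
    show "(\<lambda>n. N (y n - a) / c) \<longlonglongrightarrow> 0"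
      using tendsto_divide[OF assms tendsto_const[of c]] c(1) by simp
  qed
  then show ?thesis by (simp add: LIM_zero_iff)
qed


section \<open>The induced operator norm\<close>

text \<open>The supremum defining the operator norm carries information only if it is taken over a
  bounded set; this is where the equivalence with the Euclidean norm enters.\<close>

lemma opnorm_quotients_bdd: "bdd_above (range (\<lambda>v. N (A *v v) / N v))"
proof -
  obtain C where C: "\<And>v. N v \<le> C * norm v"
    using is_norm_le_norm by blast
  obtain c where c: "c > 0" "\<And>v. c * norm v \<le> N v"
    using norm_le_is_norm by blast
  obtain K where K: "\<And>v. norm (A *v v) \<le> K * norm v" "K > 0"
    using bounded_linear.pos_bounded[OF matrix_vector_mul_bounded_linear[of A]]
    by (auto simp: mult.commute)
  have "N (A *v v) / N v \<le> \<bar>C\<bar> * K / c" for v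
  proof (cases "v = 0")
    case True
    then show ?thesis using K(2) c(1) by (simp add: is_norm_zero)
  next
    case False
    then have pos: "N v > 0"
      using is_norm_nonneg[of v] is_norm_eq_0_iff[of v] by simp
    have "N (A *v v) \<le> \<bar>C\<bar> * norm (A *v v)"
      using C[of "A *v v"] by (rule order_trans) (simp add: mult_right_mono)
    also have "\<dots> \<le> \<bar>C\<bar> * (K * norm v)"
      by (intro mult_left_mono K(1)) simp
    also have "\<dots> \<le> \<bar>C\<bar> * (K * (N v / c))"
      using c K(2) by (intro mult_left_mono) (auto simp: field_simps)
    finally show ?thesis using pos by (simp add: field_simps)
  qed
  then show ?thesis by (intro bdd_aboveI2)
qed

lemma opnorm_bound: "N (A *v v) \<le> opnorm N A * N v"
proof (cases "v = 0")
  case True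
  then show ?thesis by (simp add: is_norm_zero)
next
  case False
  then have "N v > 0"
    using is_norm_nonneg[of v] is_norm_eq_0_iff[of v] by simp
  moreover have "N (A *v v) / N v \<le> opnorm N A"
    unfolding opnorm_def by (rule cSUP_upper[OF UNIV_I opnorm_quotients_bdd])
  ultimately show ?thesis by (simp add: field_simps)
qed

lemma opnorm_nonneg: "0 \<le> opnorm N A"
proof -
  have "N (A *v 0) / N 0 \<le> opnorm N A"
    unfolding opnorm_def by (rule cSUP_upper[OF UNIV_I opnorm_quotients_bdd])
  then show ?thesis by (simp add: is_norm_zero)
qed

lemma opnorm_leI:
  assumes "\<And>v. N (A *v v) \<le> c * N v" "c \<ge> 0"
  shows "opnorm N A \<le> c"
  unfolding opnorm_def
proof (rule cSUP_least)
  fix v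
  show "N (A *v v) / N v \<le> c"
    using assms(1)[of v] assms(2) is_norm_nonneg[of v]
    by (cases "N v = 0") (auto simp: field_simps)
qed simp

lemma opnorm_add_le: "opnorm N (A + B) \<le> opnorm N A + opnorm N B"
proof (rule opnorm_leI)
  fix v
  show "N ((A + B) *v v) \<le> (opnorm N A + opnorm N B) * N v"
    using is_norm_triangle[of "A *v v" "B *v v"] opnorm_bound[of A v] opnorm_bound[of B v]
    by (simp add: matrix_vector_mult_add_rdistrib algebra_simps)
qed (simp add: opnorm_nonneg)

lemma opnorm_diff_le: "opnorm N (A - B) \<le> opnorm N A + opnorm N B"
proof (rule opnorm_leI)
  fix v
  show "N ((A - B) *v v) \<le> (opnorm N A + opnorm N B) * N v"
    using is_norm_diff_triangle[of "A *v v" "B *v v"] opnorm_bound[of A v] opnorm_bound[of B v]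
    by (simp add: matrix_vector_mult_diff_rdistrib algebra_simps)
qed (simp add: opnorm_nonneg)

lemma opnorm_mult_le: "opnorm N (A ** B) \<le> opnorm N A * opnorm N B"
proof (rule opnorm_leI)
  fix v
  have "N (A *v (B *v v)) \<le> opnorm N A * N (B *v v)"
    by (rule opnorm_bound)
  also have "\<dots> \<le> opnorm N A * (opnorm N B * N v)"
    by (intro mult_left_mono opnorm_bound opnorm_nonneg)
  finally show "N ((A ** B) *v v) \<le> opnorm N A * opnorm N B * N v"
    by (simp add: matrix_vector_mul_assoc mult.assoc)
qed (simp add: opnorm_nonneg)


section \<open>One step of the iteration\<close>

lemma approximate_inverse_residual_le:
  "opnorm N (mat 1 - B ** P) \<le> opnorm N (mat 1 - B ** A) + opnorm N B * opnorm N (P - A)"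
proof -
  have eq: "mat 1 - B ** P = (mat 1 - B ** A) - B ** (P - A)"
    by (simp add: matrix_eq matrix_vector_mult_diff_rdistrib matrix_vector_mult_diff_distrib
        matrix_vector_mul_assoc[symmetric])
  show ?thesis
    unfolding eq
    using opnorm_diff_le[of "mat 1 - B ** A" "B ** (P - A)"] opnorm_mult_le[of B "P - A"]
    by simp
qed

text \<open>If the residual at \<open>y\<close> is \<open>P (y - a)\<close>, then the quasi-Newton step maps the error
  \<open>y - a\<close> to \<open>(I - B P) (y - a)\<close>.\<close>

lemma quasi_newton_error_le:
  assumes "f = P *v (y - a)"
  shows "N (y - B *v f - a)
    \<le> (opnorm N (mat 1 - B ** A) + opnorm N B * opnorm N (P - A)) * N (y - a)"
proof -
  have "y - B *v f - a = (mat 1 - B ** P) *v (y - a)"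
    using assms by (simp add: matrix_vector_mult_diff_rdistrib matrix_vector_mul_assoc)
  then have "N (y - B *v f - a) \<le> opnorm N (mat 1 - B ** P) * N (y - a)"
    using opnorm_bound by simp
  also have "\<dots> \<le> (opnorm N (mat 1 - B ** A) + opnorm N B * opnorm N (P - A)) * N (y - a)"
    by (intro mult_right_mono approximate_inverse_residual_le is_norm_nonneg)
  finally show ?thesis .
qed

text \<open>Since the new matrix equals \<open>B + (I - B D) B\<close>, it is larger than \<open>B\<close> by at most the factor
  \<open>1 + \<parallel>I - B D\<parallel>\<close>.\<close>

lemma opnorm_schulz_le:
  "opnorm N (2 *\<^sub>R B - B ** D ** B)
    \<le> (1 + (opnorm N (mat 1 - B ** A) + opnorm N B * opnorm N (D - A))) * opnorm N B"
proof -
  have "2 *\<^sub>R B - B ** D ** B = B + (mat 1 - B ** D) ** B"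
    by (simp add: matrix_eq matrix_vector_mult_diff_rdistrib matrix_vector_mult_add_rdistrib
        matrix_vector_mul_assoc[symmetric] scaleR_matrix_vector_assoc[symmetric]
        scaleR_2[where 'a = "real ^ 'm"])
  then have "opnorm N (2 *\<^sub>R B - B ** D ** B) \<le> opnorm N B + opnorm N (mat 1 - B ** D) * opnorm N B"
    using opnorm_add_le[of B "(mat 1 - B ** D) ** B"] opnorm_mult_le[of "mat 1 - B ** D" B] by simp
  also have "\<dots> \<le> opnorm N B
      + (opnorm N (mat 1 - B ** A) + opnorm N B * opnorm N (D - A)) * opnorm N B"
    by (intro add_left_mono mult_right_mono approximate_inverse_residual_le opnorm_nonneg)
  finally show ?thesis by (simp add: algebra_simps)
qed

text \<open>With \<open>D = A\<close> the update would square the residual \<open>I - B A\<close>, as Newton's method for matrix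
  inversion does; replacing \<open>A\<close> by \<open>D\<close> adds \<open>B (D - A) B A\<close>.\<close>

lemma schulz_residual_le:
  "opnorm N (mat 1 - (2 *\<^sub>R B - B ** D ** B) ** A)
    \<le> (opnorm N (mat 1 - B ** A))\<^sup>2 + (opnorm N B)\<^sup>2 * opnorm N (D - A) * opnorm N A"
proof -
  let ?E = "mat 1 - B ** A"
  have eq: "mat 1 - (2 *\<^sub>R B - B ** D ** B) ** A = ?E ** ?E + B ** (D - A) ** (B ** A)"
    by (simp add: matrix_eq matrix_vector_mult_diff_rdistrib matrix_vector_mult_diff_distrib
        matrix_vector_mult_add_rdistrib
        matrix_vector_mul_assoc[symmetric] scaleR_matrix_vector_assoc[symmetric]
        scaleR_2[where 'a = "real ^ 'm"])
  have "opnorm N (B ** (D - A) ** (B ** A)) \<le> opnorm N (B ** (D - A)) * opnorm N (B ** A)"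
    by (rule opnorm_mult_le)
  also have "\<dots> \<le> (opnorm N B * opnorm N (D - A)) * (opnorm N B * opnorm N A)"
    by (intro mult_mono opnorm_mult_le mult_nonneg_nonneg opnorm_nonneg)
  finally show ?thesis
    unfolding eq
    using opnorm_add_le[of "?E ** ?E" "B ** (D - A) ** (B ** A)"] opnorm_mult_le[of ?E ?E]
    by (simp add: power2_eq_square algebra_simps)
qed

end


section \<open>Convergence\<close>

text \<open>A divided difference between \<open>y\<close> and a zero \<open>a\<close> of \<open>F\<close> writes \<open>F y\<close> as a matrix close to
  \<open>A\<close> applied to the error. At \<open>y = a\<close> any matrix would do, and \<open>A\<close> itself is the closest.\<close>

lemma residual_linearised:
  assumes norm: "is_norm N" and zero: "F a = 0" and k: "k \<ge> 0"
    and dd: "y \<noteq> a \<Longrightarrow> is_divided_difference F y a (divdiff F y a)"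
    and near: "opnorm N (divdiff F y a - A) \<le> k * (N (y - a) + N (a - a))"
  obtains P where "F y = P *v (y - a)" "opnorm N (P - A) \<le> k * N (y - a)"
proof (cases "y = a")
  case True
  have "opnorm N (A - A) \<le> 0"
    using is_norm_zero[OF norm] by (intro opnorm_leI[OF norm]) simp_all
  then show ?thesis
    using that[of A] True zero k is_norm_zero[OF norm] by simp
next
  case False
  then show ?thesis
    using that[of "divdiff F y a"] dd near zero is_norm_zero[OF norm]
    by (simp add: is_divided_difference_def)
qed

theorem theorem3p3:
  fixes N :: "real ^ 'm::{finite,linorder} \<Rightarrow> real"
    and F :: "real ^ 'm::{finite,linorder} \<Rightarrow> real ^ 'm::{finite,linorder}"
    and F' :: "real ^ 'm::{finite,linorder} \<Rightarrow> real ^ 'm::{finite,linorder} ^ 'm::{finite,linorder}"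
    and \<Omega> :: "(real ^ 'm::{finite,linorder}) set"
    and xs x0 :: "real ^ 'm::{finite,linorder}"
    and B0 :: "real ^ 'm::{finite,linorder} ^ 'm::{finite,linorder}"
    and M r \<beta> \<delta> rt k :: real
    and \<alpha>0 \<beta>0 \<delta>0 \<alpha>1 \<alpha>t1 d0 \<delta>1 :: real
    and x :: "nat \<Rightarrow> real ^ 'm::{finite,linorder}"
    and B :: "nat \<Rightarrow> real ^ 'm::{finite,linorder} ^ 'm::{finite,linorder}"
  assumes norm: "is_norm N"
    and Omega: "\<Omega> \<noteq> {}" "open \<Omega>" "convex \<Omega>"
    and deriv: "\<And>y. y \<in> \<Omega> \<Longrightarrow> (F has_derivative (\<lambda>h. F' y *v h)) (at y)"
    and C1: "F xs = 0" "opnorm N (F' xs) \<le> M" "r > 0" "nball N xs r \<subseteq> \<Omega>"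
    and C2: "B0 \<noteq> 0" "opnorm N B0 = \<beta>" "opnorm N (mat 1 - B0 ** F' xs) = \<delta>" "\<delta> < 1"
    and C3: "x0 \<in> nball N xs r" "rt > 0" "x0 + F x0 \<in> nball N xs rt" "nball N xs rt \<subseteq> \<Omega>"
    and C4_ex: "\<And>y z. y \<in> \<Omega> \<Longrightarrow> z \<in> \<Omega> \<Longrightarrow> y \<noteq> z \<Longrightarrow> is_divided_difference F y z (divdiff F y z)"
    and C4: "k \<ge> 0"
      "\<And>y z. y \<in> \<Omega> \<Longrightarrow> z \<in> \<Omega> \<Longrightarrow>
         opnorm N (divdiff F y z - F' xs) \<le> k * (N (y - xs) + N (z - xs))"
    and params: "\<alpha>0 = r" "\<beta>0 = \<beta>" "\<delta>0 = \<delta>"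
      "\<alpha>1 = (\<delta> + k * \<beta> * r) * r"
      "\<alpha>t1 = (1 + M + k * \<alpha>1) * \<alpha>1"
      "d0 = \<delta> + k * \<beta> * (\<alpha>1 + \<alpha>t1)"
      "\<delta>1 = \<delta>\<^sup>2 + k * M * \<beta>\<^sup>2 * (\<alpha>1 + \<alpha>t1)"
    and r_cond: "(1 + M + k * r) * r < rt" "\<delta>1 < \<delta>0"
      "(1 + d0)\<^sup>2 * (\<delta>0 + k * \<beta> * \<alpha>0) < 1"
    and init: "x 0 = x0" "B 0 = B0"
    and step: "\<And>n. x (Suc n) = x n - B n *v F (x n)"
      "\<And>n. B (Suc n) =
         2 *\<^sub>R B n - B n ** divdiff F (x (Suc n)) (x (Suc n) + F (x (Suc n))) ** B n"
  shows "(\<forall>n. x n \<in> \<Omega> \<and> x n + F (x n) \<in> \<Omega>) \<and> x \<longlonglongrightarrow> xs"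
proof -
  let ?A = "F' xs"
  define e where "e n = N (x n - xs)" for n
  define q where "q = \<delta> + k * \<beta> * r"
  define p where "p = 1 + d0"
  note [simp] = is_norm_nonneg[OF norm] opnorm_nonneg[OF norm]
  have e_nonneg: "e n \<ge> 0" for n
    by (simp add: e_def)
  have \<beta>: "\<beta> \<ge> 0" and \<delta>: "\<delta> \<ge> 0" and M: "M \<ge> 0"
    using C1(2) C2(2,3) opnorm_nonneg[OF norm, of B0] opnorm_nonneg[OF norm, of "mat 1 - B0 ** ?A"]
      opnorm_nonneg[OF norm, of ?A] by linarith+
  have q: "q \<ge> 0"
    using \<beta> \<delta> C1(3) C4(1) by (simp add: q_def)
  have \<alpha>1: "\<alpha>1 = q * r" "\<alpha>1 \<ge> 0"
    using params(4) q C1(3) by (simp_all add: q_def)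
  have \<alpha>t1: "\<alpha>t1 \<ge> 0"
    using params(5) \<alpha>1(2) M C4(1) by simp
  have d0: "d0 \<ge> 0"
    using params(6) \<alpha>1(2) \<alpha>t1 \<beta> \<delta> C4(1) by simp
  have p: "p \<ge> 1"
    using d0 by (simp add: p_def)
  have p2q: "p\<^sup>2 * q < 1"
    using r_cond(3) params(1,2,3) by (simp add: p_def q_def)
  have pq: "p * q \<le> p\<^sup>2 * q" and q_le: "q \<le> p\<^sup>2 * q"
    using p q mult_right_mono[of p "p\<^sup>2" q] mult_right_mono[of 1 "p\<^sup>2" q]
    by (auto simp: one_le_power self_le_power)
  have q1: "q < 1"
    using q_le p2q by linarith
  have e0: "e 0 < r"
    using C3(1) init(1) by (simp add: e_def nball_def)
  have qn_e0: "q ^ n * e 0 \<le> e 0" for n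
    using power_le_one[of q n] q q1 e_nonneg[of 0] mult_right_mono[of "q ^ n" 1 "e 0"] by simp
  have xs_in: "xs \<in> \<Omega>"
    using C1(3,4) is_norm_zero[OF norm] by (auto simp: nball_def)

  have in_\<Omega>: "y \<in> \<Omega>" if "N (y - xs) < r" for y
    using that C1(4) by (auto simp: nball_def)
  have lin: "\<exists>P. F y = P *v (y - xs) \<and> opnorm N (P - ?A) \<le> k * N (y - xs)" if "y \<in> \<Omega>" for y
    using residual_linearised[OF norm C1(1) C4(1) C4_ex[OF that xs_in] C4(2)[OF that xs_in]] by blast

  \<comment> \<open>The radius \<open>c\<close> is left open: \<open>c = r\<close> keeps the shifted points in the domain, while \<open>c = \<alpha>1\<close>
    reproduces the constant in \<open>\<alpha>t1\<close>.\<close>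
  have shifted: "N (y + F y - xs) \<le> (1 + M + k * c) * N (y - xs)"
    if y: "y \<in> \<Omega>" and c: "N (y - xs) \<le> c" for y c
  proof -
    obtain P where P: "F y = P *v (y - xs)" "opnorm N (P - ?A) \<le> k * N (y - xs)"
      using lin[OF y] by blast
    have "opnorm N P \<le> opnorm N (P - ?A) + opnorm N ?A"
      using opnorm_add_le[OF norm, of "P - ?A" ?A] by simp
    also have "\<dots> \<le> k * c + M"
      using P(2) C1(2) mult_left_mono[OF c C4(1)] by linarith
    finally have "N (F y) \<le> (M + k * c) * N (y - xs)"
      using opnorm_bound[OF norm, of P "y - xs"] P(1)
        mult_right_mono[of "opnorm N P" "M + k * c" "N (y - xs)"] by simp
    then show ?thesis
      using is_norm_triangle[OF norm, of "y - xs" "F y"] by (simp add: algebra_simps)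
  qed
  have shifted_in_\<Omega>: "y + F y \<in> \<Omega>" if y: "N (y - xs) < r" for y
  proof -
    have "N (y + F y - xs) \<le> (1 + M + k * r) * N (y - xs)"
      using shifted[OF in_\<Omega>[OF y]] y by simp
    also have "\<dots> \<le> (1 + M + k * r) * r"
      using y M C4(1) C1(3) by (intro mult_left_mono) auto
    finally show ?thesis
      using r_cond(1) C3(4) by (auto simp: nball_def)
  qed

  \<comment> \<open>The growth bound on \<open>B n\<close> cannot be separated from the other two: keeping \<open>I - B n A\<close> within
    \<open>\<delta>\<close> needs the decay of the error to outweigh the square of that growth.\<close>
  have inv: "e n \<le> q ^ n * e 0 \<and> opnorm N (B n) \<le> p ^ n * \<beta> \<and> opnorm N (mat 1 - B n ** ?A) \<le> \<delta>"
    for n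
  proof (induction n)
    case 0
    then show ?case using C2(2,3) init(2) by simp
  next
    case (Suc n)
    then have en: "e n \<le> q ^ n * e 0" and bn: "opnorm N (B n) \<le> p ^ n * \<beta>"
      and dn: "opnorm N (mat 1 - B n ** ?A) \<le> \<delta>" by auto
    let ?y = "x (Suc n)"
    have en_r: "e n \<le> q ^ n * r"
      using en mult_left_mono[of "e 0" r "q ^ n"] e0 q by simp
    have "e n < r"
      using en qn_e0[of n] e0 by linarith
    then obtain P where P: "F (x n) = P *v (x n - xs)" "opnorm N (P - ?A) \<le> k * e n"
      using lin[OF in_\<Omega>] by (auto simp: e_def)

    have pqn: "(p * q) ^ n \<le> 1" and p2qn: "(p\<^sup>2 * q) ^ n \<le> 1"
      using p q p2q pq by (auto intro!: power_le_one)
    \<comment> \<open>With this bound the error is multiplied by at most \<open>q = \<delta> + k \<beta> r\<close>, the estimate for the first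
      step, although \<open>B n\<close> may have grown.\<close>
    have be: "opnorm N (B n) * (k * e n) \<le> k * \<beta> * r"
    proof -
      have "opnorm N (B n) * (k * e n) \<le> (p ^ n * \<beta>) * (k * (q ^ n * r))"
        using bn en_r C4(1) e_nonneg p \<beta> by (intro mult_mono) auto
      also have "\<dots> = (p * q) ^ n * (k * \<beta> * r)"
        by (simp add: power_mult_distrib)
      also have "\<dots> \<le> 1 * (k * \<beta> * r)"
        using C4(1) \<beta> C1(3) by (intro mult_right_mono pqn) auto
      finally show ?thesis by simp
    qed
    have e_Suc: "e (Suc n) \<le> q * e n"
    proof -
      have "e (Suc n) \<le> (opnorm N (mat 1 - B n ** ?A) + opnorm N (B n) * opnorm N (P - ?A)) * e n"
        using quasi_newton_error_le[OF norm P(1)] by (simp add: step(1) e_def)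
      also have "\<dots> \<le> q * e n"
        using dn be mult_left_mono[OF P(2), of "opnorm N (B n)"]
        by (intro mult_right_mono e_nonneg) (simp add: q_def)
      finally show ?thesis .
    qed
    have e_Suc': "e (Suc n) \<le> q ^ Suc n * e 0"
      using e_Suc mult_left_mono[OF en q] by (simp add: mult.assoc)
    have "q * e n \<le> q ^ n * \<alpha>1"
      using mult_left_mono[OF en_r q] by (simp add: \<alpha>1(1) algebra_simps)
    with e_Suc have e_Suc_\<alpha>1: "e (Suc n) \<le> q ^ n * \<alpha>1"
      by linarith
    have "q ^ n * \<alpha>1 \<le> \<alpha>1"
      using power_le_one[of q n] q q1 \<alpha>1(2) mult_right_mono[of "q ^ n" 1 \<alpha>1] by simp
    then have le_\<alpha>1: "e (Suc n) \<le> \<alpha>1"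
      using e_Suc_\<alpha>1 by linarith
    have "q * r < r"
      using q1 C1(3) by simp
    then have y_near: "N (?y - xs) < r"
      using le_\<alpha>1 \<alpha>1(1) by (simp add: e_def)

    define D where "D = divdiff F ?y (?y + F ?y)"
    define s where "s = N (?y - xs) + N (?y + F ?y - xs)"
    have D: "opnorm N (D - ?A) \<le> k * s"
      unfolding D_def s_def by (rule C4(2)[OF in_\<Omega>[OF y_near] shifted_in_\<Omega>[OF y_near]])
    \<comment> \<open>\<open>\<alpha>1 + \<alpha>t1\<close> bounds \<open>s\<close> for \<open>n = 0\<close>. As \<open>s\<close> is at most a fixed multiple of the
      error, its bound decays at the same rate \<open>q\<close>.\<close>
    have s: "s \<le> q ^ n * (\<alpha>1 + \<alpha>t1)"
    proof -
      have "N (?y + F ?y - xs) \<le> (1 + M + k * \<alpha>1) * e (Suc n)"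
        using shifted[OF in_\<Omega>[OF y_near]] le_\<alpha>1 by (simp add: e_def)
      also have "\<dots> \<le> (1 + M + k * \<alpha>1) * (q ^ n * \<alpha>1)"
        using e_Suc_\<alpha>1 M C4(1) \<alpha>1(2) by (intro mult_left_mono) auto
      finally show ?thesis
        using e_Suc_\<alpha>1 by (simp add: s_def e_def params(5) algebra_simps)
    qed
    have "k * s \<le> k * (q ^ n * (\<alpha>1 + \<alpha>t1))"
      by (rule mult_left_mono[OF s C4(1)])
    with D have D': "opnorm N (D - ?A) \<le> k * (q ^ n * (\<alpha>1 + \<alpha>t1))"
      by linarith

    have "opnorm N (B n) * opnorm N (D - ?A) \<le> (p ^ n * \<beta>) * (k * (q ^ n * (\<alpha>1 + \<alpha>t1)))"
      using bn D' p \<beta> by (intro mult_mono) auto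
    also have "\<dots> = (p * q) ^ n * (k * \<beta> * (\<alpha>1 + \<alpha>t1))"
      by (simp add: power_mult_distrib)
    also have "\<dots> \<le> 1 * (k * \<beta> * (\<alpha>1 + \<alpha>t1))"
      using C4(1) \<beta> \<alpha>1(2) \<alpha>t1 by (intro mult_right_mono pqn) auto
    finally have bD: "opnorm N (B n) * opnorm N (D - ?A) \<le> k * \<beta> * (\<alpha>1 + \<alpha>t1)"
      by simp
    have "opnorm N (B (Suc n))
        \<le> (1 + (opnorm N (mat 1 - B n ** ?A) + opnorm N (B n) * opnorm N (D - ?A))) * opnorm N (B n)"
      using opnorm_schulz_le[OF norm, of "B n" D ?A] by (simp add: step(2) D_def)
    also have "\<dots> \<le> p * (p ^ n * \<beta>)"
      using dn bD bn p by (intro mult_mono) (auto simp: p_def params(6))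
    finally have b_Suc: "opnorm N (B (Suc n)) \<le> p ^ Suc n * \<beta>"
      by (simp add: mult.assoc)

    have "(opnorm N (B n))\<^sup>2 * opnorm N (D - ?A) * opnorm N ?A
        \<le> (p ^ n * \<beta>)\<^sup>2 * (k * (q ^ n * (\<alpha>1 + \<alpha>t1))) * M"
      using bn D' C1(2) C4(1) q \<alpha>1(2) \<alpha>t1 by (intro mult_mono power_mono) auto
    also have "\<dots> = (p\<^sup>2 * q) ^ n * (k * M * \<beta>\<^sup>2 * (\<alpha>1 + \<alpha>t1))"
      by (simp add: power_mult_distrib power2_eq_square)
    also have "\<dots> \<le> 1 * (k * M * \<beta>\<^sup>2 * (\<alpha>1 + \<alpha>t1))"
      using C4(1) M \<alpha>1(2) \<alpha>t1 by (intro mult_right_mono p2qn) auto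
    finally have corr: "(opnorm N (B n))\<^sup>2 * opnorm N (D - ?A) * opnorm N ?A
        \<le> k * M * \<beta>\<^sup>2 * (\<alpha>1 + \<alpha>t1)"
      by simp
    have "(opnorm N (mat 1 - B n ** ?A))\<^sup>2 \<le> \<delta>\<^sup>2"
      by (rule power_mono[OF dn]) simp
    then have "opnorm N (mat 1 - B (Suc n) ** ?A) \<le> \<delta>1"
      using schulz_residual_le[OF norm, of "B n" D ?A] corr by (simp add: step(2) D_def params(7))
    then have "opnorm N (mat 1 - B (Suc n) ** ?A) \<le> \<delta>"
      using r_cond(2) params(3) by linarith
    with e_Suc' b_Suc show ?case by blast
  qed

  have near: "N (x n - xs) < r" for n
    using inv[of n] qn_e0[of n] e0 by (simp add: e_def)
  have "(\<lambda>n. q ^ n * e 0) \<longlonglongrightarrow> 0"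
    using tendsto_mult_left_zero[OF LIMSEQ_realpow_zero[OF q q1]] .
  then have "(\<lambda>n. N (x n - xs)) \<longlonglongrightarrow> 0"
    by (rule Lim_null_comparison[rotated]) (use inv in \<open>auto simp: e_def\<close>)
  then have "x \<longlonglongrightarrow> xs"
    by (rule tendsto_if_is_norm_tendsto_0[OF norm])
  then show ?thesis
    using in_\<Omega>[OF near] shifted_in_\<Omega>[OF near] by blast
qed

end
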